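(* Consider the problem $\mathsf{Deg\text{-}Seq}$ where the input consists of a positive integer $n$, a sequence $d_1, \ldots, d_n$, followed by a list of directed edges $(u_1,v_1), \ldots, (u_m,v_m)$ with $u_i, v_i \in \{1,\ldots,n\}$ in an arbitrary order, and the task is to decide whether, for every $j$, the out-degree of vertex $j$ (the number of $i$ with $u_i=j$) equals $d_j$. Then: (1) any $p$-pass randomized streaming algorithm for $\mathsf{Deg\text{-}Seq}$ with probability of error bounded by a constant $\epsilon < \frac{1}{2}$ must use $\Omega((\log n)/p)$ space; (2) any $p$-pass deterministic streaming algorithm for $\mathsf{Deg\text{-}Seq}$ must use $\Omega(n/p)$ space.
   Context: A $p$-pass streaming algorithm reads its input sequentially from left to right $p$ times; its space is the number of bits of working memory used. *)

theory Defs
  imports "HOL-Probability.Probability_Mass_Function"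
begin

section \<open>The problem Deg-Seq\<close>

definition deg_seq_input :: "nat \<Rightarrow> nat list \<Rightarrow> (nat \<times> nat) list \<Rightarrow> bool" where
  "deg_seq_input n ds es \<longleftrightarrow> 0 < n \<and> length ds = n \<and> set es \<subseteq> {1..n} \<times> {1..n}"

definition out_degree :: "(nat \<times> nat) list \<Rightarrow> nat \<Rightarrow> nat" where
  "out_degree es j = card {i. i < length es \<and> fst (es ! i) = j}"

text \<open>The degree \<open>d\<^sub>j\<close> prescribed for vertex \<open>j \<in> {1..n}\<close> is the list entry \<open>ds ! (j - 1)\<close>.\<close>

definition deg_seq :: "nat \<Rightarrow> nat list \<Rightarrow> (nat \<times> nat) list \<Rightarrow> bool" where
  "deg_seq n ds es \<longleftrightarrow> (\<forall>j\<in>{1..n}. out_degree es j = ds ! (j - 1))"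

text \<open>The kind of a stream item is visible to the algorithm, so that it need not count in order to
  know whether it is reading degrees or edges.  Every pass starts with the item \<open>Size n\<close>.\<close>

datatype item = Size nat | Deg nat | Edge "nat \<times> nat"

definition stream :: "nat \<Rightarrow> nat list \<Rightarrow> (nat \<times> nat) list \<Rightarrow> item list" where
  "stream n ds es = Size n # map Deg ds @ map Edge es"

text \<open>What is read in \<open>p\<close> passes over \<open>xs\<close>; every item is paired with the number of its pass.\<close>

definition passes :: "nat \<Rightarrow> item list \<Rightarrow> (nat \<times> item) list" where
  "passes p xs = concat (map (\<lambda>i. map (Pair i) xs) [0..<p])"


section \<open>Streaming algorithms\<close>

text \<open>All information carried from one stream item to the next is the content of the working memory,
  a list of bits.  Beyond that nothing is assumed about the computation: the transition may be an
  arbitrary function of the pass, the memory and the current item.  A randomized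
  algorithm tosses fresh coins in each transition; outcomes that are to be used again
  have to be kept in the memory.\<close>

type_synonym memory = "bool list"

record det_alg =
  det_init :: memory
  det_step :: "nat \<Rightarrow> memory \<Rightarrow> item \<Rightarrow> memory"
  det_out :: "memory \<Rightarrow> bool"

record rand_alg =
  rand_init :: memory
  rand_step :: "nat \<Rightarrow> memory \<Rightarrow> item \<Rightarrow> memory pmf"
  rand_out :: "memory \<Rightarrow> bool pmf"

definition det_run :: "det_alg \<Rightarrow> (nat \<times> item) list \<Rightarrow> memory" where
  "det_run A ys = foldl (\<lambda>\<sigma> (i, x). det_step A i \<sigma> x) (det_init A) ys"

definition rand_run :: "rand_alg \<Rightarrow> (nat \<times> item) list \<Rightarrow> memory pmf" where
  "rand_run A ys =
     foldl (\<lambda>M (i, x). bind_pmf M (\<lambda>\<sigma>. rand_step A i \<sigma> x)) (return_pmf (rand_init A)) ys"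

definition det_answer :: "det_alg \<Rightarrow> nat \<Rightarrow> item list \<Rightarrow> bool" where
  "det_answer A p xs = det_out A (det_run A (passes p xs))"

definition rand_answer :: "rand_alg \<Rightarrow> nat \<Rightarrow> item list \<Rightarrow> bool pmf" where
  "rand_answer A p xs = bind_pmf (rand_run A (passes p xs)) (rand_out A)"

definition det_solves_deg_seq :: "det_alg \<Rightarrow> nat \<Rightarrow> nat \<Rightarrow> bool" where
  "det_solves_deg_seq A p n \<longleftrightarrow>
     (\<forall>ds es. deg_seq_input n ds es \<longrightarrow> det_answer A p (stream n ds es) = deg_seq n ds es)"

definition rand_solves_deg_seq :: "rand_alg \<Rightarrow> nat \<Rightarrow> real \<Rightarrow> nat \<Rightarrow> bool" where
  "rand_solves_deg_seq A p \<epsilon> n \<longleftrightarrow>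
     (\<forall>ds es. deg_seq_input n ds es \<longrightarrow>
        measure_pmf.prob (rand_answer A p (stream n ds es)) {b. b \<noteq> deg_seq n ds es} \<le> \<epsilon>)"


section \<open>Space\<close>

text \<open>The prefixes \<open>take k\<close> range over all moments of the computation; for randomized algorithms
  the worst case over all coin tosses counts.\<close>

definition det_space_le :: "det_alg \<Rightarrow> nat \<Rightarrow> item list \<Rightarrow> nat \<Rightarrow> bool" where
  "det_space_le A p xs s \<longleftrightarrow> (\<forall>k. length (det_run A (take k (passes p xs))) \<le> s)"

definition rand_space_le :: "rand_alg \<Rightarrow> nat \<Rightarrow> item list \<Rightarrow> nat \<Rightarrow> bool" where
  "rand_space_le A p xs s \<longleftrightarrow>
     (\<forall>k. \<forall>\<sigma>\<in>set_pmf (rand_run A (take k (passes p xs))). length \<sigma> \<le> s)"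

text \<open>Space as a function of \<open>n\<close> is the worst case over the inputs in which all numbers are at
  most \<open>n\<close>.  Without a bound on the \<open>d\<^sub>j\<close> a space bound in terms of \<open>n\<close> alone would be
  unsatisfiable, since a correct algorithm has to distinguish infinitely many values of \<open>d\<^sub>1\<close>, and
  lower bounds would hold for this trivial reason.  Correctness, in contrast, is required on all
  inputs.\<close>

definition deg_seq_det_space_le :: "det_alg \<Rightarrow> nat \<Rightarrow> nat \<Rightarrow> nat \<Rightarrow> bool" where
  "deg_seq_det_space_le A p n s \<longleftrightarrow>
     (\<forall>ds es. deg_seq_input n ds es \<and> (\<forall>d\<in>set ds. d \<le> n) \<longrightarrow> det_space_le A p (stream n ds es) s)"

definition deg_seq_rand_space_le :: "rand_alg \<Rightarrow> nat \<Rightarrow> nat \<Rightarrow> nat \<Rightarrow> bool" where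
  "deg_seq_rand_space_le A p n s \<longleftrightarrow>
     (\<forall>ds es. deg_seq_input n ds es \<and> (\<forall>d\<in>set ds. d \<le> n) \<longrightarrow> rand_space_le A p (stream n ds es) s)"

end

theory Submission
  imports Defs
begin

text \<open>Restrict to degree sequences and edge lists that encode subsets \<open>X, Y \<subseteq> {1..n}\<close>, so
  that an algorithm has to decide whether \<open>X = Y\<close>. The list of memory contents at the \<open>2p\<close>
  moments where the degrees or the edges end takes at most \<open>K = 4\<^sup>2\<^sup>p\<^sup>s\<close> values
  \<open>\<tau>\<close>, and its probability is a product \<open>a X \<tau> * b Y \<tau>\<close>. If the algorithm
  never errs, the values \<open>\<tau>\<close> of accepting runs on \<open>(X, X)\<close> are distinct for distinct
  \<open>X\<close>, so \<open>2\<^sup>n \<le> K\<close>. With error \<open>\<epsilon>\<close>, the vectors \<open>a X\<close> differ from each other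
  by \<open>(1 - 2\<epsilon>) / K\<close> in some coordinate, so rounding them to a grid shows that
  \<open>2\<^sup>n\<close> is at most about \<open>(K / (1 - 2\<epsilon>))\<^sup>K\<close>, whence \<open>n = O(K\<^sup>2)\<close>.\<close>

section \<open>Equality from sums of products\<close>

text \<open>A fooling-set argument: each \<open>x\<close> has some \<open>t\<close> at which
  \<open>a x t\<close> and \<open>b x t\<close> are both positive, and if \<open>x\<close> and
  \<open>y\<close> shared this \<open>t\<close>, the mixed sum would be positive.\<close>

lemma card_le_if_products_separate:
  fixes a b :: "'x \<Rightarrow> 't \<Rightarrow> real"
  assumes fin: "finite R"
    and nonneg: "\<And>x t. 0 \<le> a x t" "\<And>x t. 0 \<le> b x t"
    and diag: "\<And>x. x \<in> X \<Longrightarrow> 0 < (\<Sum>t\<in>R. a x t * b x t)"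
    and off: "\<And>x y. x \<in> X \<Longrightarrow> y \<in> X \<Longrightarrow> x \<noteq> y \<Longrightarrow> (\<Sum>t\<in>R. a x t * b y t) = 0"
  shows "card X \<le> card R"
proof -
  have "\<exists>t\<in>R. 0 < a x t \<and> 0 < b x t" if "x \<in> X" for x
  proof (rule ccontr)
    assume none: "\<not> (\<exists>t\<in>R. 0 < a x t \<and> 0 < b x t)"
    have "a x t * b x t = 0" if "t \<in> R" for t
    proof -
      have "\<not> (0 < a x t \<and> 0 < b x t)" using none that by blast
      then show ?thesis using nonneg(1)[of x t] nonneg(2)[of x t] by auto
    qed
    then have "(\<Sum>t\<in>R. a x t * b x t) = 0" by (intro sum.neutral ballI)
    then show False using diag[OF \<open>x \<in> X\<close>] by simp
  qed
  then obtain w where w: "\<And>x. x \<in> X \<Longrightarrow> w x \<in> R \<and> 0 < a x (w x) \<and> 0 < b x (w x)"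
    by metis
  have "inj_on w X"
  proof (rule inj_onI, rule ccontr)
    fix x y assume xy: "x \<in> X" "y \<in> X" "w x = w y" "x \<noteq> y"
    \<comment> \<open>A vanishing sum of nonnegative terms vanishes term by term.\<close>
    have "a x (w x) * b y (w x) = 0"
      using sum_nonneg_0[OF fin _ off[OF xy(1,2,4)]] w[OF xy(1)] nonneg
      by (meson mult_nonneg_nonneg)
    then show False using w[OF xy(1)] w[OF xy(2)] xy(3) by simp
  qed
  then show ?thesis using w fin by (intro card_inj_on_le) auto
qed

text \<open>If \<open>a x\<close> and \<open>a y\<close> lie in the same cell of a grid of width
  \<open>1 / m\<close>, then \<open>b \<le> 1\<close> lets the sums differ by at most
  \<open>card R / m < \<delta>\<close>. So distinct \<open>x\<close> occupy distinct cells.\<close>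

lemma card_le_if_products_differ:
  fixes a b :: "'x \<Rightarrow> 't \<Rightarrow> real"
  assumes fin: "finite R"
    and a: "\<And>x t. 0 \<le> a x t" "\<And>x t. a x t \<le> 1"
    and b: "\<And>x t. 0 \<le> b x t" "\<And>x t. b x t \<le> 1"
    and sep: "\<And>x y. x \<in> X \<Longrightarrow> y \<in> X \<Longrightarrow> x \<noteq> y \<Longrightarrow>
      \<delta> \<le> (\<Sum>t\<in>R. a x t * b x t) - (\<Sum>t\<in>R. a y t * b x t)"
    and \<delta>: "0 < \<delta>" and m: "real (card R) < \<delta> * real m"
  shows "card X \<le> (m + 1) ^ card R"
proof -
  \<comment> \<open>Rounding down to multiples of \<open>1 / m\<close>; \<open>restrict\<close>
    fixes the values off \<open>R\<close>, so that \<open>q\<close> maps into the finite set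
    \<open>R \<rightarrow>\<^sub>E {..m}\<close>.\<close>
  define q where "q x = restrict (\<lambda>t. nat \<lfloor>a x t * real m\<rfloor>) R" for x
  have m0: "0 < m" using m by (cases m) auto
  have "inj_on q X"
  proof (rule inj_onI, rule ccontr)
    fix x y assume xy: "x \<in> X" "y \<in> X" "q x = q y" "x \<noteq> y"
    have "a x t * b x t - a y t * b x t \<le> 1 / real m" if "t \<in> R" for t
    proof -
      have "nat \<lfloor>a x t * real m\<rfloor> = nat \<lfloor>a y t * real m\<rfloor>"
        using fun_cong[OF xy(3), of t] that by (simp add: q_def)
      moreover have "0 \<le> a x t * real m" "0 \<le> a y t * real m" using a by auto
      ultimately have "\<lfloor>a x t * real m\<rfloor> = \<lfloor>a y t * real m\<rfloor>"
        by (metis eq_nat_nat_iff zero_le_floor)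
      then have "a x t * real m - a y t * real m \<le> 1" by linarith
      then have "a x t - a y t \<le> 1 / real m" using m0 by (simp add: field_simps)
      \<comment> \<open>A factor in [0, 1] shrinks a nonnegative difference and keeps a negative one
        at most 0.\<close>
      then have "(a x t - a y t) * b x t \<le> 1 / real m"
        using b[of x t] m0
        by (smt (verit) divide_nonneg_nonneg mult_left_le mult_nonneg_nonneg
            mult_nonpos_nonneg of_nat_0_le_iff)
      then show ?thesis by (simp add: left_diff_distrib)
    qed
    then have "(\<Sum>t\<in>R. a x t * b x t - a y t * b x t) \<le> real (card R) * (1 / real m)"
      by (rule sum_bounded_above)
    also have "\<dots> < \<delta>" using m m0 by (simp add: field_simps)
    finally show False using sep[OF xy(1,2,4)] by (simp add: sum_subtractf)
  qed
  moreover have "q ` X \<subseteq> R \<rightarrow>\<^sub>E {..m}"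
  proof -
    have "nat \<lfloor>a x t * real m\<rfloor> \<le> m" for x t
    proof -
      have "a x t * real m \<le> real m" using a[of x t] by (simp add: mult_left_le_one_le)
      then show ?thesis by linarith
    qed
    then show ?thesis by (auto simp: q_def)
  qed
  moreover have "finite (R \<rightarrow>\<^sub>E {..m})" using fin by (simp add: finite_PiE)
  ultimately have "card X \<le> card (R \<rightarrow>\<^sub>E {..m})" by (rule card_inj_on_le)
  then show ?thesis using fin by (simp add: card_PiE)
qed


section \<open>Transcripts\<close>

text \<open>The chain rule: since the first outcome is kept in the pair, only the branch
  \<open>x' = x\<close> can produce \<open>(x, y)\<close>.\<close>

lemma pmf_bind_map_Pair:
  "pmf (bind_pmf M (\<lambda>x. map_pmf (Pair x) (N x))) (x, y) = pmf M x * pmf (N x) y"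
proof -
  have "pmf (map_pmf (Pair x') (N x')) (x, y) = indicator {x} x' * pmf (N x) y" for x'
  proof (cases "x' = x")
    case True
    then show ?thesis by (simp add: pmf_map_inj' inj_on_def)
  next
    case False
    then have "(x, y) \<notin> set_pmf (map_pmf (Pair x') (N x'))" by auto
    then have "pmf (map_pmf (Pair x') (N x')) (x, y) = 0" by (rule pmf_eq_0_set_pmf[THEN iffD2])
    then show ?thesis using False by simp
  qed
  then show ?thesis by (simp add: pmf_bind measure_pmf_single)
qed

text \<open>The Markov kernel of reading \<open>ys\<close>: the starting memory is left free, so
  that runs can be cut at any item.\<close>

definition kernel :: "rand_alg \<Rightarrow> (nat \<times> item) list \<Rightarrow> memory \<Rightarrow> memory pmf" where
  "kernel A ys \<sigma> =
     foldl (\<lambda>M (i, x). bind_pmf M (\<lambda>\<sigma>. rand_step A i \<sigma> x)) (return_pmf \<sigma>) ys"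

text \<open>The Markov property: the rest of a run depends on the past only through the current
  memory. \<open>M\<close> is arbitrary in the induction because each item replaces it.\<close>

lemma foldl_bind_pmf:
  "foldl (\<lambda>M z. bind_pmf M (\<lambda>\<sigma>. f \<sigma> z)) M zs =
     bind_pmf M (\<lambda>\<sigma>. foldl (\<lambda>M z. bind_pmf M (\<lambda>\<sigma>. f \<sigma> z)) (return_pmf \<sigma>) zs)"
proof (induction zs arbitrary: M)
  case Nil
  show ?case by (simp add: bind_return_pmf')
next
  case (Cons z zs)
  show ?case
    by (simp add: Cons[of "bind_pmf M _"] Cons[of "f _ z"] bind_assoc_pmf bind_return_pmf)
qed

lemma rand_run_append: "rand_run A (ys @ zs) = bind_pmf (rand_run A ys) (kernel A zs)"
  unfolding rand_run_def kernel_def foldl_append case_prod_unfold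
  by (rule foldl_bind_pmf[where f = "\<lambda>\<sigma> z. rand_step A (fst z) \<sigma> (snd z)"])

lemma passes_Suc: "passes (Suc i) zs = passes i zs @ map (Pair i) zs"
  by (simp add: passes_def)

lemma passes_split:
  assumes "i \<le> p"
  obtains vs where "passes p zs = passes i zs @ vs"
proof
  have "[0..<p] = [0..<i] @ [i..<p]" using assms upt_add_eq_append[of 0 i "p - i"] by simp
  then show "passes p zs = passes i zs @ concat (map (\<lambda>i. map (Pair i) zs) [i..<p])"
    by (simp add: passes_def)
qed

text \<open>The latest pass comes first; each pass contributes the memory between its two halves and
  the memory at its end.\<close>

definition final_memory :: "rand_alg \<Rightarrow> (memory \<times> memory) list \<Rightarrow> memory" where
  "final_memory A \<tau> = (case \<tau> of [] \<Rightarrow> rand_init A | (\<sigma>, \<rho>) # _ \<Rightarrow> \<rho>)"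

lemma final_memory_simps [simp]:
  "final_memory A [] = rand_init A" "final_memory A (z # \<tau>) = snd z"
  by (simp_all add: final_memory_def case_prod_unfold)

text \<open>Here \<open>xs\<close> and \<open>ys\<close> are the two halves of the stream, as held
  by two players of a communication protocol. Every step keeps its history via \<open>Pair\<close>,
  so that \<open>pmf_bind_map_Pair\<close> evaluates the joint distribution.\<close>

primrec transcript ::
  "rand_alg \<Rightarrow> item list \<Rightarrow> item list \<Rightarrow> nat \<Rightarrow> (memory \<times> memory) list pmf" where
  "transcript A xs ys 0 = return_pmf []"
| "transcript A xs ys (Suc i) = map_pmf (\<lambda>(\<tau>, z). z # \<tau>)
     (bind_pmf (transcript A xs ys i) (\<lambda>\<tau>. map_pmf (Pair \<tau>)
       (bind_pmf (kernel A (map (Pair i) xs) (final_memory A \<tau>)) (\<lambda>\<sigma>. map_pmf (Pair \<sigma>)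
         (kernel A (map (Pair i) ys) \<sigma>)))))"

text \<open>The factor of the transcript probability that is due to \<open>xs\<close>. As the latest
  pass comes first and passes are counted from 0, \<open>length \<tau>\<close> is the number of the
  pass recorded in \<open>z\<close>.\<close>

primrec left_weight :: "rand_alg \<Rightarrow> item list \<Rightarrow> (memory \<times> memory) list \<Rightarrow> real" where
  "left_weight A xs [] = 1"
| "left_weight A xs (z # \<tau>) = left_weight A xs \<tau> *
     pmf (kernel A (map (Pair (length \<tau>)) xs) (final_memory A \<tau>)) (fst z)"

primrec right_weight :: "rand_alg \<Rightarrow> item list \<Rightarrow> (memory \<times> memory) list \<Rightarrow> real" where
  "right_weight A ys [] = 1"
| "right_weight A ys (z # \<tau>) = right_weight A ys \<tau> *
     pmf (kernel A (map (Pair (length \<tau>)) ys) (fst z)) (snd z)"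

lemma left_weight_bounds: "0 \<le> left_weight A xs \<tau>" "left_weight A xs \<tau> \<le> 1"
proof -
  have "0 \<le> left_weight A xs \<tau> \<and> left_weight A xs \<tau> \<le> 1"
    by (induction \<tau>) (auto intro: mult_le_one pmf_le_1)
  then show "0 \<le> left_weight A xs \<tau>" "left_weight A xs \<tau> \<le> 1" by auto
qed

lemma right_weight_bounds: "0 \<le> right_weight A ys \<tau>" "right_weight A ys \<tau> \<le> 1"
proof -
  have "0 \<le> right_weight A ys \<tau> \<and> right_weight A ys \<tau> \<le> 1"
    by (induction \<tau>) (auto intro: mult_le_one pmf_le_1)
  then show "0 \<le> right_weight A ys \<tau>" "right_weight A ys \<tau> \<le> 1" by auto
qed

text \<open>Given the history, each transition depends on only one of \<open>xs\<close> and
  \<open>ys\<close>, so the factors from the chain rule can be regrouped by halves. This is the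
  rectangle property of communication protocols.\<close>

lemma pmf_transcript:
  "pmf (transcript A xs ys (length \<tau>)) \<tau> = left_weight A xs \<tau> * right_weight A ys \<tau>"
proof (induction \<tau>)
  case Nil
  show ?case by simp
next
  case (Cons z \<tau>)
  have inj: "inj (\<lambda>(\<tau>, z). z # \<tau>)" by (auto simp: inj_on_def)
  show ?case
    using pmf_map_inj'[OF inj, of _ "(\<tau>, z)"]
    by (cases z) (simp add: pmf_bind_map_Pair Cons)
qed

text \<open>Forgetting all but the last memory recovers the actual run; this ties transcripts to
  answers and to space.\<close>

lemma map_final_memory_transcript:
  "map_pmf (final_memory A) (transcript A xs ys i) = rand_run A (passes i (xs @ ys))"
proof (induction i)
  case 0
  show ?case by (simp add: passes_def rand_run_def)
next
  case (Suc i)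
  have "map_pmf (final_memory A) (transcript A xs ys (Suc i)) =
      bind_pmf (transcript A xs ys i) (\<lambda>\<tau>.
        bind_pmf (kernel A (map (Pair i) xs) (final_memory A \<tau>)) (kernel A (map (Pair i) ys)))"
    by (simp add: map_bind_pmf pmf.map_comp o_def)
  also have "\<dots> = bind_pmf (map_pmf (final_memory A) (transcript A xs ys i)) (\<lambda>\<rho>.
        bind_pmf (kernel A (map (Pair i) xs) \<rho>) (kernel A (map (Pair i) ys)))"
    by (simp add: bind_map_pmf)
  also have "\<dots> = rand_run A (passes (Suc i) (xs @ ys))"
    by (simp add: Suc passes_Suc rand_run_append bind_assoc_pmf flip: append_assoc)
  finally show ?case .
qed

lemma rand_space_le_prefix:
  assumes "rand_space_le A p zs s" "passes p zs = us @ vs" "\<sigma> \<in> set_pmf (rand_run A us)"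
  shows "length \<sigma> \<le> s"
  using assms unfolding rand_space_le_def by (metis append_eq_conv_conj)

definition transcripts :: "nat \<Rightarrow> nat \<Rightarrow> (memory \<times> memory) list set" where
  "transcripts s p = {\<tau>. set \<tau> \<subseteq> {\<sigma>. length \<sigma> \<le> s} \<times> {\<sigma>. length \<sigma> \<le> s} \<and> length \<tau> = p}"

text \<open>Both contents recorded in a pass are memories reached after some prefix of the
  \<open>p\<close> passes, where the space bound applies.\<close>

lemma set_pmf_transcript:
  assumes "rand_space_le A p (xs @ ys) s" "i \<le> p"
  shows "set_pmf (transcript A xs ys i) \<subseteq> transcripts s i"
  using assms(2)
proof (induction i)
  case 0
  then show ?case by (simp add: transcripts_def)
next
  case (Suc i)
  obtain vs where vs: "passes p (xs @ ys) = passes (Suc i) (xs @ ys) @ vs"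
    using passes_split[OF Suc.prems] .
  show ?case
  proof
    fix \<tau>' assume "\<tau>' \<in> set_pmf (transcript A xs ys (Suc i))"
    then obtain \<tau> \<sigma> \<rho> where \<tau>: "\<tau> \<in> set_pmf (transcript A xs ys i)"
      and \<sigma>: "\<sigma> \<in> set_pmf (kernel A (map (Pair i) xs) (final_memory A \<tau>))"
      and \<rho>: "\<rho> \<in> set_pmf (kernel A (map (Pair i) ys) \<sigma>)" and \<tau>': "\<tau>' = (\<sigma>, \<rho>) # \<tau>"
      by auto
    have "final_memory A \<tau> \<in> set_pmf (rand_run A (passes i (xs @ ys)))"
      using \<tau> by (simp flip: map_final_memory_transcript)
    then have run: "\<sigma> \<in> set_pmf (rand_run A (passes i (xs @ ys) @ map (Pair i) xs))"
      using \<sigma> by (auto simp: rand_run_append)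
    then have "\<rho> \<in> set_pmf (rand_run A ((passes i (xs @ ys) @ map (Pair i) xs) @ map (Pair i) ys))"
      using \<rho> by (subst rand_run_append) auto
    then have "length \<rho> \<le> s"
      using vs by (intro rand_space_le_prefix[OF assms(1)]) (auto simp: passes_Suc)
    moreover have "length \<sigma> \<le> s"
      using vs run by (intro rand_space_le_prefix[OF assms(1)]) (auto simp: passes_Suc)
    ultimately show "\<tau>' \<in> transcripts s (Suc i)"
      using Suc.IH Suc.prems \<tau> \<tau>' by (auto simp: transcripts_def)
  qed
qed

section \<open>Counting transcripts\<close>

lemma finite_memories: "finite {\<sigma> :: memory. length \<sigma> \<le> s}"
  using finite_lists_length_le[of "UNIV :: bool set" s] by simp

lemma card_memories: "card {\<sigma> :: memory. length \<sigma> \<le> s} \<le> 4 ^ s"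
proof -
  have "card {\<sigma> :: memory. length \<sigma> \<le> s} = (\<Sum>i\<le>s. 2 ^ i)"
    using card_lists_length_le[of "UNIV :: bool set" s] by simp
  \<comment> \<open>The sum is \<open>2 ^ (s + 1) - 1\<close>. The coarser \<open>4 ^ s\<close> has
    no additive term in its exponent, so that the count of transcripts has an exponent proportional
    to \<open>p * s\<close>.\<close>
  also have "\<dots> \<le> 4 ^ s"
  proof (induction s)
    case (Suc s)
    have "(2::nat) ^ s \<le> 4 ^ s" by (simp add: power_mono)
    then show ?case using Suc by simp
  qed simp
  finally show ?thesis .
qed

lemma finite_transcripts: "finite (transcripts s p)"
  unfolding transcripts_def
  by (rule finite_lists_length_eq) (simp add: finite_memories)

lemma card_transcripts: "card (transcripts s p) \<le> 2 ^ (4 * p * s)"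
proof -
  let ?S = "{\<sigma> :: memory. length \<sigma> \<le> s}"
  have "card (transcripts s p) = (card ?S * card ?S) ^ p"
    unfolding transcripts_def
    by (subst card_lists_length_eq) (simp_all add: finite_memories card_cartesian_product)
  also have "\<dots> \<le> (4 ^ s * 4 ^ s) ^ p"
    by (intro power_mono mult_le_mono card_memories) simp
  also have "\<dots> = 2 ^ (4 * p * s)"
  proof -
    have "(4::nat) ^ s = 2 ^ (2 * s)" by (simp add: power_mult)
    moreover have "(2 * s + 2 * s) * p = 4 * p * s" by (simp add: algebra_simps)
    ultimately show ?thesis by (metis power_add power_mult)
  qed
  finally show ?thesis .
qed

text \<open>Total probability over transcripts. The acceptance probability is determined by
  \<open>\<tau>\<close> alone, so it can join the factor of \<open>ys\<close>.\<close>

lemma pmf_rand_answer: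
  assumes "rand_space_le A p (xs @ ys) s"
  shows "pmf (rand_answer A p (xs @ ys)) True = (\<Sum>\<tau>\<in>transcripts s p.
    left_weight A xs \<tau> * (right_weight A ys \<tau> * pmf (rand_out A (final_memory A \<tau>)) True))"
proof -
  have "pmf (rand_answer A p (xs @ ys)) True =
      (\<integral>\<tau>. pmf (rand_out A (final_memory A \<tau>)) True \<partial>measure_pmf (transcript A xs ys p))"
    by (simp add: rand_answer_def bind_map_pmf pmf_bind flip: map_final_memory_transcript)
  also have "\<dots> = (\<Sum>\<tau>\<in>transcripts s p. pmf (rand_out A (final_memory A \<tau>)) True *
      pmf (transcript A xs ys p) \<tau>)"
    using set_pmf_transcript[OF assms order_refl]
    by (intro integral_measure_pmf_real finite_transcripts) auto
  \<comment> \<open>Members of \<open>transcripts s p\<close> have length \<open>p\<close>, which is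
    the form that \<open>pmf_transcript\<close> needs.\<close>
  also have "\<dots> = (\<Sum>\<tau>\<in>transcripts s p.
    left_weight A xs \<tau> * (right_weight A ys \<tau> * pmf (rand_out A (final_memory A \<tau>)) True))"
    using pmf_transcript[of A xs ys] by (intro sum.cong) (auto simp: transcripts_def)
  finally show ?thesis .
qed


section \<open>Degree sequences of subsets\<close>

definition indicator_degs :: "nat \<Rightarrow> nat set \<Rightarrow> nat list" where
  "indicator_degs n X = map (\<lambda>j. of_bool (j \<in> X)) [1..<Suc n]"

text \<open>The target 1 is an arbitrary choice: only sources enter the out-degree.\<close>

definition indicator_edges :: "nat \<Rightarrow> nat set \<Rightarrow> (nat \<times> nat) list" where
  "indicator_edges n Y = map (\<lambda>j. (j, 1)) (filter (\<lambda>j. j \<in> Y) [1..<Suc n])"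

lemma out_degree_indicator_edges:
  assumes "j \<in> {1..n}"
  shows "out_degree (indicator_edges n Y) j = of_bool (j \<in> Y)"
proof -
  have "out_degree (indicator_edges n Y) j = length (filter (\<lambda>i. i = j \<and> i \<in> Y) [1..<Suc n])"
    unfolding out_degree_def length_filter_conv_card[of "\<lambda>e. fst e = j", symmetric]
    by (simp add: indicator_edges_def filter_map o_def conj_commute del: upt_Suc)
  also have "\<dots> = card {i \<in> {1..n}. i = j \<and> i \<in> Y}"
    by (subst distinct_length_filter) (auto intro!: arg_cong[where f = card] simp del: upt_Suc)
  also have "{i \<in> {1..n}. i = j \<and> i \<in> Y} = (if j \<in> Y then {j} else {})"
    using assms by auto
  finally show ?thesis by simp
qed

text \<open>The reduction from equality testing: one half of the stream encodes \<open>X\<close>,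
  the other \<open>Y\<close>.\<close>

lemma deg_seq_indicator:
  assumes "X \<subseteq> {1..n}" "Y \<subseteq> {1..n}"
  shows "deg_seq n (indicator_degs n X) (indicator_edges n Y) \<longleftrightarrow> X = Y"
proof -
  have "indicator_degs n X ! (j - 1) = of_bool (j \<in> X)" if "j \<in> {1..n}" for j
  proof -
    have "j - 1 < length [1..<Suc n]" "[1..<Suc n] ! (j - 1) = j"
      using that by (auto simp del: upt_Suc)
    then show ?thesis unfolding indicator_degs_def by (simp only: nth_map)
  qed
  then have "deg_seq n (indicator_degs n X) (indicator_edges n Y) \<longleftrightarrow>
      (\<forall>j\<in>{1..n}. j \<in> Y \<longleftrightarrow> j \<in> X)"
    by (auto simp: deg_seq_def out_degree_indicator_edges)
  then show ?thesis using assms by blast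
qed

lemma deg_seq_input_indicator:
  assumes "0 < n"
  shows "deg_seq_input n (indicator_degs n X) (indicator_edges n Y)"
  using assms by (auto simp: deg_seq_input_def indicator_degs_def indicator_edges_def)

text \<open>Puts the encoded inputs among those over which space is measured.\<close>

lemma indicator_degs_le:
  assumes "0 < n" "d \<in> set (indicator_degs n X)"
  shows "d \<le> n"
  using assms by (auto simp: indicator_degs_def)

definition degs_weight :: "rand_alg \<Rightarrow> nat \<Rightarrow> nat set \<Rightarrow> (memory \<times> memory) list \<Rightarrow> real" where
  "degs_weight A n X = left_weight A (Size n # map Deg (indicator_degs n X))"

definition edges_weight :: "rand_alg \<Rightarrow> nat \<Rightarrow> nat set \<Rightarrow> (memory \<times> memory) list \<Rightarrow> real" where
  "edges_weight A n Y \<tau> = right_weight A (map Edge (indicator_edges n Y)) \<tau> *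
     pmf (rand_out A (final_memory A \<tau>)) True"

lemma degs_weight_bounds: "0 \<le> degs_weight A n X \<tau>" "degs_weight A n X \<tau> \<le> 1"
  by (simp_all add: degs_weight_def left_weight_bounds)

lemma edges_weight_bounds: "0 \<le> edges_weight A n Y \<tau>" "edges_weight A n Y \<tau> \<le> 1"
  by (auto simp: edges_weight_def right_weight_bounds pmf_le_1 intro: mult_le_one)

lemma pmf_rand_answer_indicator:
  assumes n: "0 < n" and sp: "deg_seq_rand_space_le A p n s"
  shows "pmf (rand_answer A p (stream n (indicator_degs n X) (indicator_edges n Y))) True =
    (\<Sum>\<tau>\<in>transcripts s p. degs_weight A n X \<tau> * edges_weight A n Y \<tau>)"
proof -
  let ?l = "Size n # map Deg (indicator_degs n X)" and ?r = "map Edge (indicator_edges n Y)"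
  have stream: "stream n (indicator_degs n X) (indicator_edges n Y) = ?l @ ?r"
    by (simp add: stream_def)
  have "rand_space_le A p (?l @ ?r) s"
    using sp deg_seq_input_indicator[OF n, of X Y] indicator_degs_le[OF n, of _ X]
    unfolding deg_seq_rand_space_le_def stream[symmetric] by blast
  from pmf_rand_answer[OF this] show ?thesis
    by (simp only: stream degs_weight_def edges_weight_def)
qed

text \<open>The acceptance probabilities form a matrix indexed by subsets that is entrywise within
  \<open>\<epsilon>\<close> of the identity: an error is a rejection on the diagonal and an
  acceptance off it.\<close>

lemma rand_solves_deg_seq_indicator:
  assumes n: "0 < n" and sol: "rand_solves_deg_seq A p \<epsilon> n" and sp: "deg_seq_rand_space_le A p n s"
    and XY: "X \<subseteq> {1..n}" "Y \<subseteq> {1..n}"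
  shows "X = Y \<Longrightarrow> 1 - \<epsilon> \<le> (\<Sum>\<tau>\<in>transcripts s p. degs_weight A n X \<tau> * edges_weight A n Y \<tau>)"
    and "X \<noteq> Y \<Longrightarrow> (\<Sum>\<tau>\<in>transcripts s p. degs_weight A n X \<tau> * edges_weight A n Y \<tau>) \<le> \<epsilon>"
proof -
  let ?M = "rand_answer A p (stream n (indicator_degs n X) (indicator_edges n Y))"
  have err: "measure_pmf.prob ?M {c. c \<noteq> (X = Y)} \<le> \<epsilon>"
    using sol deg_seq_input_indicator[OF n, of X Y]
    unfolding rand_solves_deg_seq_def deg_seq_indicator[OF XY, symmetric] by blast
  have eqs: "{c. \<not> c} = {False}" "{c. c} = {True}" by auto
  show "1 - \<epsilon> \<le> (\<Sum>\<tau>\<in>transcripts s p. degs_weight A n X \<tau> * edges_weight A n Y \<tau>)" if "X = Y"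
    using err that eqs
    by (simp add: measure_pmf_single pmf_False_conv_True pmf_rand_answer_indicator[OF n sp])
  show "(\<Sum>\<tau>\<in>transcripts s p. degs_weight A n X \<tau> * edges_weight A n Y \<tau>) \<le> \<epsilon>" if "X \<noteq> Y"
    using err that eqs by (simp add: measure_pmf_single pmf_rand_answer_indicator[OF n sp])
qed


section \<open>Space bounds\<close>

lemma zero_error_space_bound:
  assumes "0 < n" "rand_solves_deg_seq A p 0 n" "deg_seq_rand_space_le A p n s"
  shows "n \<le> 4 * p * s"
proof -
  have "card (Pow {1..n}) \<le> card (transcripts s p)"
  proof (rule card_le_if_products_separate[where a = "degs_weight A n" and b = "edges_weight A n"])
    fix X assume "X \<in> Pow {1..n}"
    then show "0 < (\<Sum>\<tau>\<in>transcripts s p. degs_weight A n X \<tau> * edges_weight A n X \<tau>)" 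
      using rand_solves_deg_seq_indicator(1)[OF assms, of X X] by simp
  next
    fix X Y assume "X \<in> Pow {1..n}" "Y \<in> Pow {1..n}" "X \<noteq> Y"
    \<comment> \<open>The error bound gives only \<open>\<le> 0\<close>; nonnegative weights give
      the other direction.\<close>
    then show "(\<Sum>\<tau>\<in>transcripts s p. degs_weight A n X \<tau> * edges_weight A n Y \<tau>) = 0"
      using rand_solves_deg_seq_indicator(2)[OF assms, of X Y] by (intro antisym sum_nonneg mult_nonneg_nonneg
          degs_weight_bounds edges_weight_bounds) auto
  qed (auto simp: degs_weight_bounds edges_weight_bounds finite_transcripts)
  also have "card (Pow {1..n}) = 2 ^ n" by (simp add: card_Pow)
  also note card_transcripts[of s p]
  finally show ?thesis by (rule power_le_imp_le_exp[rotated]) simp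
qed

text \<open>In the column of \<open>X\<close>, the rows of \<open>X\<close> and \<open>Y\<close>
  differ by at least \<open>(1 - \<epsilon>) - \<epsilon>\<close>, which is the gap that
  \<open>card_le_if_products_differ\<close> needs.\<close>

lemma bounded_error_space_bound:
  assumes n: "0 < n" and \<epsilon>: "\<epsilon> < 1/2"
    and sol: "rand_solves_deg_seq A p \<epsilon> n" "deg_seq_rand_space_le A p n s"
  shows "real n \<le> 2 ^ (8 * p * s) * (1 / (1 - 2 * \<epsilon>) + 2)"
proof -
  define \<delta> where "\<delta> = 1 - 2 * \<epsilon>"
  define K where "K = (2::nat) ^ (4 * p * s)"
  \<comment> \<open>The least integer above \<open>K / \<delta>\<close>: the grid is just fine
    enough for \<open>K / m < \<delta>\<close>.\<close>
  define m where "m = nat \<lfloor>real K / \<delta>\<rfloor> + 1"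
  have \<delta>: "0 < \<delta>" using \<epsilon> by (simp add: \<delta>_def)
  have K1: "1 \<le> K" by (simp add: K_def)
  have m_gt: "real K / \<delta> < real m" and m_le: "real m \<le> real K / \<delta> + 1"
  proof -
    have "0 \<le> real K / \<delta>" using \<delta> by simp
    then show "real K / \<delta> < real m" "real m \<le> real K / \<delta> + 1"
      unfolding m_def by linarith+
  qed
  have "card (Pow {1..n}) \<le> (m + 1) ^ card (transcripts s p)"
  proof (rule card_le_if_products_differ[where a = "degs_weight A n" and b = "edges_weight A n" and \<delta> = \<delta>])
    fix X Y assume "X \<in> Pow {1..n}" "Y \<in> Pow {1..n}" "X \<noteq> Y"
    then show "\<delta> \<le> (\<Sum>\<tau>\<in>transcripts s p. degs_weight A n X \<tau> * edges_weight A n X \<tau>) - (\<Sum>\<tau>\<in>transcripts s p. degs_weight A n Y \<tau> * edges_weight A n X \<tau>)"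
      using rand_solves_deg_seq_indicator(1)[OF n sol, of X X]
        rand_solves_deg_seq_indicator(2)[OF n sol, of Y X] by (simp add: \<delta>_def)
  next
    have "real (card (transcripts s p)) \<le> real K"
      using card_transcripts[of s p] unfolding K_def by (rule of_nat_mono)
    also have "\<dots> < \<delta> * real m" using m_gt \<delta> by (simp add: field_simps)
    finally show "real (card (transcripts s p)) < \<delta> * real m" .
  qed (auto simp: degs_weight_bounds edges_weight_bounds finite_transcripts \<delta>)
  also have "\<dots> \<le> (m + 1) ^ K"
    using card_transcripts[of s p] unfolding K_def by (intro power_increasing) auto
  \<comment> \<open>A crude estimate that makes both sides powers of 2; its loss affects only the
    constant in front of \<open>log 2 n\<close>.\<close>
  also have "\<dots> \<le> (2 ^ (m + 1)) ^ K"
    by (intro power_mono less_imp_le[OF less_exp]) simp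
  finally have "(2::nat) ^ n \<le> 2 ^ ((m + 1) * K)"
    unfolding power_mult[symmetric]
    by (simp only: card_Pow finite_atLeastAtMost card_atLeastAtMost diff_Suc_1)
  then have "n \<le> (m + 1) * K" by (rule power_le_imp_le_exp[rotated]) simp
  then have "real n \<le> (real m + 1) * real K" by (metis of_nat_1 of_nat_add of_nat_mono of_nat_mult)
  \<comment> \<open>\<open>1 \<le> K\<close> absorbs the additive 2 into \<open>2 * K\<close>,
    leaving a multiple of \<open>K ^ 2\<close>.\<close>
  also have "\<dots> \<le> (real K / \<delta> + 2 * real K) * real K"
    using m_le K1 by (intro mult_right_mono) auto
  also have "\<dots> = real K ^ 2 * (1 / \<delta> + 2)" by (simp add: algebra_simps power2_eq_square)
  also have "real K ^ 2 = 2 ^ (8 * p * s)" by (simp add: K_def flip: power_mult)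
  finally show ?thesis by (simp add: \<delta>_def)
qed

section \<open>Deterministic algorithms as randomized ones with error 0\<close>

definition rand_of_det :: "det_alg \<Rightarrow> rand_alg" where
  "rand_of_det A = \<lparr>rand_init = det_init A,
     rand_step = (\<lambda>i \<sigma> x. return_pmf (det_step A i \<sigma> x)),
     rand_out = (\<lambda>\<sigma>. return_pmf (det_out A \<sigma>))\<rparr>"

lemma rand_run_rand_of_det: "rand_run (rand_of_det A) ys = return_pmf (det_run A ys)"
  by (induction ys rule: rev_induct)
    (auto simp: rand_run_def det_run_def rand_of_det_def bind_return_pmf)

lemma rand_of_det_solves:
  assumes "det_solves_deg_seq A p n"
  shows "rand_solves_deg_seq (rand_of_det A) p 0 n"
proof -
  have "rand_answer (rand_of_det A) p xs = return_pmf (det_answer A p xs)" for xs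
    unfolding rand_answer_def rand_run_rand_of_det
    by (simp add: bind_return_pmf det_answer_def rand_of_det_def)
  then show ?thesis using assms by (auto simp: rand_solves_deg_seq_def det_solves_deg_seq_def)
qed

lemma rand_of_det_space:
  assumes "deg_seq_det_space_le A p n s"
  shows "deg_seq_rand_space_le (rand_of_det A) p n s"
  using assms
  by (simp add: deg_seq_rand_space_le_def deg_seq_det_space_le_def rand_space_le_def
      det_space_le_def rand_run_rand_of_det)

theorem theorem7:
  "(\<forall>\<epsilon>::real. 0 \<le> \<epsilon> \<and> \<epsilon> < 1/2 \<longrightarrow>
      (\<exists>c::real. 0 < c \<and> (\<exists>N::nat. \<forall>n\<ge>N. \<forall>p::nat. 1 \<le> p \<longrightarrow> (\<forall>(A::rand_alg) (s::nat).
         rand_solves_deg_seq A p \<epsilon> n \<and> deg_seq_rand_space_le A p n s \<longrightarrow>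
         c * (log 2 (real n) / real p) \<le> real s)))) \<and>
   (\<exists>c::real. 0 < c \<and> (\<exists>N::nat. \<forall>n\<ge>N. \<forall>p::nat. 1 \<le> p \<longrightarrow> (\<forall>(A::det_alg) (s::nat).
      det_solves_deg_seq A p n \<and> deg_seq_det_space_le A p n s \<longrightarrow>
      c * (real n / real p) \<le> real s)))"
proof (intro conjI allI impI)
  fix \<epsilon> :: real assume \<epsilon>: "0 \<le> \<epsilon> \<and> \<epsilon> < 1/2"
  define C where "C = 1 / (1 - 2 * \<epsilon>) + 2"
  have C: "1 \<le> C" using \<epsilon> by (simp add: C_def)
  \<comment> \<open>The space bound gives \<open>log 2 n \<le> 8 * p * s + log 2 C\<close>. For
    \<open>n \<ge> C ^ 2\<close> the last term is at most half of the left side, which doubles 8 to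
    16.\<close>
  have "1/16 * (log 2 (real n) / real p) \<le> real s"
    if n: "n \<ge> nat \<lceil>C ^ 2\<rceil>" and p: "1 \<le> p"
      and sol: "rand_solves_deg_seq A p \<epsilon> n" "deg_seq_rand_space_le A p n s" for n p A s
  proof -
    have nC: "C ^ 2 \<le> real n" using n by linarith
    then have n0: "0 < n" using C by (smt (verit) gr0I of_nat_0 one_le_power)
    have "real n \<le> 2 ^ (8 * p * s) * C"
      using bounded_error_space_bound[OF n0 _ sol] \<epsilon> by (simp add: C_def)
    then have "log 2 (real n) \<le> log 2 (2 ^ (8 * p * s) * C)"
      using n0 by (intro log_mono) auto
    also have "\<dots> = real (8 * p * s) + log 2 C" using C by (simp add: log_mult log_nat_power)
    finally have "log 2 (real n) \<le> 8 * (real p * real s) + log 2 C" by simp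
    moreover have "2 * log 2 C \<le> log 2 (real n)"
    proof -
      have "2 * log 2 C = log 2 (C ^ 2)" using C by (simp add: log_nat_power)
      also have "\<dots> \<le> log 2 (real n)" using nC C by (intro log_mono) auto
      finally show ?thesis .
    qed
    ultimately have "log 2 (real n) \<le> 16 * (real p * real s)" by simp
    then show ?thesis using p by (simp add: field_simps)
  qed
  then show "\<exists>c::real. 0 < c \<and> (\<exists>N::nat. \<forall>n\<ge>N. \<forall>p::nat. 1 \<le> p \<longrightarrow> (\<forall>(A::rand_alg) (s::nat).
      rand_solves_deg_seq A p \<epsilon> n \<and> deg_seq_rand_space_le A p n s \<longrightarrow>
      c * (log 2 (real n) / real p) \<le> real s))"
    by (intro exI[of _ "1/16"] exI[of _ "nat \<lceil>C ^ 2\<rceil>"] conjI) auto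
next
  \<comment> \<open>The constant comes from \<open>n \<le> 4 * p * s\<close>, and the threshold 1
    excludes \<open>n = 0\<close>.\<close>
  have "1/4 * (real n / real p) \<le> real s"
    if "n \<ge> 1" and p: "1 \<le> p" and "det_solves_deg_seq A p n" "deg_seq_det_space_le A p n s"
    for n p A s
  proof -
    have "n \<le> 4 * p * s"
      using zero_error_space_bound[OF _ rand_of_det_solves rand_of_det_space] that by simp
    then have "real n \<le> 4 * real p * real s" by (metis of_nat_mono of_nat_mult of_nat_numeral)
    then show ?thesis using p by (simp add: field_simps)
  qed
  then show "\<exists>c::real. 0 < c \<and> (\<exists>N::nat. \<forall>n\<ge>N. \<forall>p::nat. 1 \<le> p \<longrightarrow> (\<forall>(A::det_alg) (s::nat).
      det_solves_deg_seq A p n \<and> deg_seq_det_space_le A p n s \<longrightarrow>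
      c * (real n / real p) \<le> real s))"
    by (intro exI[of _ "1/4"] exI[of _ 1] conjI) auto
qed

end
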